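(* For all $n\geq 3$, the cycle $C_n$ has the smallest number of connected induced subgraphs among all connected graphs of order $n$ with no cut vertex; that is, $\mathrm{N}(G)\ge \mathrm{N}(C_n)$ for every connected graph $G$ with $n$ vertices and no cut vertex.
   Context: All graphs are finite and simple. A cut vertex of a graph $G$ is a vertex $u$ such that $G-u$ has more connected components than $G$. $\mathrm{N}(G)$ denotes the number of connected induced subgraphs of $G$, i.e. the number of nonempty subsets of $V(G)$ inducing a connected graph. $C_n$ is the cycle on $n$ vertices. *)

theory Defs
  imports "Graph_Theory.Digraph_Component"
begin

text \<open>
  Finite simple graphs are modelled by the locale \<^locale>\<open>graph\<close>, that is, as finite symmetric
  digraphs without loops and without parallel arcs: an edge \<open>uv\<close> is a pair of opposite arcs.
  Since \<^const>\<open>connected\<close> excludes the null graph, so do connected components.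
\<close>

definition components :: "('a, 'b) pre_digraph \<Rightarrow> ('a, 'b) pre_digraph set" where
  "components G = {H. pre_digraph.max_subgraph G connected H}"

definition cut_vertex :: "('a, 'b) pre_digraph \<Rightarrow> 'a \<Rightarrow> bool" where
  "cut_vertex G u \<longleftrightarrow>
     u \<in> verts G \<and> card (components (pre_digraph.del_vert G u)) > card (components G)"

definition num_connected_induced :: "('a, 'b) pre_digraph \<Rightarrow> nat" where
  "num_connected_induced G = card {S. S \<subseteq> verts G \<and> S \<noteq> {} \<and> connected (G \<restriction> S)}"

text \<open>The cycle on the vertices \<open>0, \<dots>, n - 1\<close>; it is a simple graph for \<open>n \<ge> 3\<close>.\<close>

definition cycle_graph :: "nat \<Rightarrow> (nat, nat \<times> nat) pre_digraph" where
  "cycle_graph n =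
     \<lparr> verts = {..<n},
       arcs = {(i, j). i < n \<and> j < n \<and> (j = Suc i mod n \<or> i = Suc j mod n)},
       tail = fst, head = snd \<rparr>"

lemma strongly_connected_imp_connected:
  assumes "wf_digraph G" "strongly_connected G"
  shows "connected G"
proof -
  interpret wf_digraph G by fact
  show ?thesis
    using assms(2)
    by (intro connectedI) (auto simp: strongly_connected_def intro: reachable_mk_symmetricI)
qed

lemma components_eq_sccs:
  assumes "sym_digraph G"
  shows "components G = pre_digraph.sccs G"
proof -
  interpret sym_digraph G by fact
  have sc: "strongly_connected (G \<restriction> verts H)" and sub: "subgraph H (G \<restriction> verts H)"
    if "subgraph H G" "connected H" for H
  proof -
    have vs: "verts H \<subseteq> verts G" using that(1) by auto
    interpret I: wf_digraph "G \<restriction> verts H" by (rule wellformed_induce_subgraph)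
    have sym: "symmetric (G \<restriction> verts H)"
      using sym_arcs induced_induce[OF vs] by (rule induced_graph_imp_symmetric)
    show sub: "subgraph H (G \<restriction> verts H)"
      using that(1) unfolding subgraph_def compatible_def
      by (auto simp: wf_digraph_def)
    have "spanning H (G \<restriction> verts H)" using sub by (simp add: spanning_def)
    then have "connected (G \<restriction> verts H)"
      using that(2) by (rule I.connected_spanning_imp_connected)
    with sym show "strongly_connected (G \<restriction> verts H)"
      by (rule I.symmetric_connected_imp_strongly_connected)
  qed
  have ind: "subgraph (G \<restriction> verts H) G" if "subgraph H G" for H
    using induced_induce[of "verts H"] that by (auto simp: induced_subgraph_def)
  have conn: "connected H" if "subgraph H G" "strongly_connected H" for H
    using that by (intro strongly_connected_imp_connected) auto
  have "max_subgraph connected H \<longleftrightarrow> max_subgraph strongly_connected H" for H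
  proof
    assume H: "max_subgraph connected H"
    then have 1: "subgraph H G" "connected H" by (auto simp: max_subgraph_def)
    have "G \<restriction> verts H = H"
      using H sub[OF 1] ind[OF 1(1)] conn[OF ind[OF 1(1)] sc[OF 1]]
      unfolding max_subgraph_def by blast
    with sc[OF 1] have "strongly_connected H" by simp
    with H conn show "max_subgraph strongly_connected H"
      unfolding max_subgraph_def by blast
  next
    assume H: "max_subgraph strongly_connected H"
    then have 1: "subgraph H G" "strongly_connected H" by (auto simp: max_subgraph_def)
    have "H' = H" if H': "subgraph H H'" "subgraph H' G" "connected H'" for H'
    proof -
      have "subgraph H (G \<restriction> verts H')"
        using H'(1) sub[OF H'(2,3)] by (rule subgraph_trans)
      then have eq: "G \<restriction> verts H' = H"
        using H ind[OF H'(2)] sc[OF H'(2,3)] unfolding max_subgraph_def by blast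
      with sub[OF H'(2,3)] have "subgraph H' H" by simp
      with H'(1) show ?thesis
        by (auto simp: subgraph_def compatible_def intro!: pre_digraph.equality)
    qed
    with 1 conn show "max_subgraph connected H" unfolding max_subgraph_def by blast
  qed
  then show ?thesis by (simp add: components_def sccs_altdef2)
qed

lemma graph_cycle_graph:
  assumes "n \<ge> 3"
  shows "graph (cycle_graph n)"
proof -
  have fin: "finite {(i, j). i < n \<and> j < n \<and> (j = Suc i mod n \<or> i = Suc j mod n)}"
    by (rule finite_subset[of _ "{..<n} \<times> {..<n}"]) auto
  have ne: "Suc i mod n \<noteq> i" if "i < n" for i
    using assms that by (cases "Suc i = n") auto
  show ?thesis
    using assms fin
    by unfold_locales
      (auto simp: cycle_graph_def symmetric_def arcs_ends_def arc_to_ends_def sym_def image_iff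
        ne ne[symmetric])
qed

lemma strongly_connected_cycle_graph_del_vert:
  assumes n: "n \<ge> 3" and u: "u < n"
  shows "strongly_connected (pre_digraph.del_vert (cycle_graph n) u)" (is "strongly_connected ?D")
proof -
  interpret graph "cycle_graph n" by (rule graph_cycle_graph[OF n])
  interpret D: wf_digraph ?D by (rule wf_digraph_del_vert)
  have sym: "symmetric ?D"
    by (auto simp: cycle_graph_def pre_digraph.del_vert_def symmetric_def arcs_ends_def arc_to_ends_def
        sym_def image_iff)
  have ne: "(u + k) mod n \<noteq> u" if "0 < k" "k < n" for k
  proof (cases "u + k < n")
    case False
    then have "(u + k) mod n = u + k - n" using u that by (simp add: mod_if)
    then show ?thesis using that False by linarith
  qed (use that in simp)
  let ?r = "(u + 1) mod n"
  have reach: "Suc k < n \<Longrightarrow> ?r \<rightarrow>\<^sup>*\<^bsub>?D\<^esub> ((u + Suc k) mod n)" for k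
  proof (induction k)
    case 0
    have "?r \<in> verts ?D" using n ne[of 1] by (simp add: pre_digraph.del_vert_def cycle_graph_def)
    then show ?case by simp
  next
    case (Suc k)
    let ?i = "(u + Suc k) mod n" and ?j = "(u + Suc (Suc k)) mod n"
    have "(?i, ?j) \<in> arcs ?D"
      using Suc.prems ne[of "Suc k"] ne[of "Suc (Suc k)"] n
      by (simp add: pre_digraph.del_vert_def cycle_graph_def mod_Suc_eq)
    then have "?i \<rightarrow>\<^bsub>?D\<^esub> ?j"
      by (force simp: arcs_ends_def arc_to_ends_def pre_digraph.del_vert_def cycle_graph_def image_iff)
    with Suc show ?case using D.reachable_adj_trans by simp
  qed
  have all: "?r \<rightarrow>\<^sup>*\<^bsub>?D\<^esub> v" if "v \<in> verts ?D" for v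
  proof -
    have v: "v < n" "v \<noteq> u" using that by (auto simp: pre_digraph.del_vert_def cycle_graph_def)
    define k where "k = (if u < v then v - u - 1 else n + v - u - 1)"
    have k: "Suc k < n" using v u by (auto simp: k_def)
    have "u + Suc k = (if u < v then v else v + n)" using v u by (auto simp: k_def)
    then have "(u + Suc k) mod n = v" using v by simp
    with reach[OF k] show ?thesis by simp
  qed
  show ?thesis
  proof (rule strongly_connectedI)
    have "?r \<in> verts ?D" using n ne[of 1] by (simp add: pre_digraph.del_vert_def cycle_graph_def)
    then show "verts ?D \<noteq> {}" by blast
  next
    fix v w assume "v \<in> verts ?D" "w \<in> verts ?D"
    then show "v \<rightarrow>\<^sup>*\<^bsub>?D\<^esub> w"
      using symmetric_reachable[OF sym all] all D.reachable_trans by blast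
  qed
qed

lemma card_verts_cycle_graph: "card (verts (cycle_graph n)) = n"
  by (simp add: cycle_graph_def)

lemma connected_cycle_graph:
  assumes n: "n \<ge> 3"
  shows "connected (cycle_graph n)"
proof (rule strongly_connected_imp_connected)
  interpret graph "cycle_graph n" by (rule graph_cycle_graph[OF n])
  show "wf_digraph (cycle_graph n)" by unfold_locales
  have reach: "k < n \<Longrightarrow> 0 \<rightarrow>\<^sup>*\<^bsub>cycle_graph n\<^esub> k" for k
  proof (induction k)
    case 0
    then have "0 \<in> verts (cycle_graph n)" by (simp add: cycle_graph_def)
    then show ?case by simp
  next
    case (Suc k)
    have "(k, Suc k) \<in> arcs (cycle_graph n)" using Suc.prems by (simp add: cycle_graph_def)
    then have "k \<rightarrow>\<^bsub>cycle_graph n\<^esub> Suc k"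
      by (force simp: arcs_ends_def arc_to_ends_def cycle_graph_def image_iff)
    with Suc show ?case using reachable_adj_trans by simp
  qed
  show "strongly_connected (cycle_graph n)"
  proof (rule strongly_connectedI)
    show "verts (cycle_graph n) \<noteq> {}" using n by (simp add: cycle_graph_def lessThan_empty_iff)
  next
    fix v w assume "v \<in> verts (cycle_graph n)" "w \<in> verts (cycle_graph n)"
    then have "v < n" "w < n" by (auto simp: cycle_graph_def)
    then show "v \<rightarrow>\<^sup>*\<^bsub>cycle_graph n\<^esub> w"
      using symmetric_reachable[OF sym_arcs reach] reach reachable_trans by blast
  qed
qed

lemma not_cut_vertex_cycle_graph:
  assumes n: "n \<ge> 3"
  shows "\<not> cut_vertex (cycle_graph n) u"
proof
  assume c: "cut_vertex (cycle_graph n) u"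
  then have u: "u < n" by (simp add: cut_vertex_def cycle_graph_def)
  interpret graph "cycle_graph n" by (rule graph_cycle_graph[OF n])
  let ?D = "del_vert u"
  interpret D: wf_digraph ?D by (rule wf_digraph_del_vert)
  have sym: "symmetric ?D"
    by (auto simp: cycle_graph_def pre_digraph.del_vert_def symmetric_def arcs_ends_def arc_to_ends_def
        sym_def image_iff)
  have "components ?D = {?D}"
    using D.sym_digraphI[OF sym] strongly_connected_cycle_graph_del_vert[OF n u]
    by (simp add: components_eq_sccs D.strongly_connected_eq_iff)
  moreover have "components (cycle_graph n) = {cycle_graph n}"
    using symmetric_connected_imp_strongly_connected[OF sym_arcs connected_cycle_graph[OF n]]
      sym_digraph_axioms
    by (simp add: components_eq_sccs strongly_connected_eq_iff)
  ultimately show False using c by (simp add: cut_vertex_def)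
qed

end

theory Submission
  imports Defs
begin

text \<open>
  Both graphs are compared with \<open>n (n - 1) + 1\<close>. In the cycle, a connected proper vertex set is an
  arc, hence given by its starting point (\<open>n\<close> choices) and its length (\<open>n - 1\<close> choices); the full
  vertex set accounts for the remaining one (lemma \<open>card_conn_sets_cycle_le\<close>).

  That a graph without cut vertices has at least \<open>n (n - 1) + 1\<close> connected sets is shown by
  induction on \<open>n\<close>, contracting an edge \<open>uv\<close> (lemma \<open>card_conn_sets_biconn\<close>). Every connected set of
  the contracted graph lifts to a connected set of the original graph that contains both or neither
  of \<open>u\<close> and \<open>v\<close>. The sets that contain exactly one of them are new, and there are at least
  \<open>2 (n - 1)\<close>: the graph without \<open>v\<close> is connected and has \<open>n - 1\<close> vertices, so a connected set grown
  vertex by vertex from \<open>u\<close> inside it passes through \<open>n - 1\<close> sizes; likewise with \<open>u\<close> and \<open>v\<close>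
  exchanged (lemma \<open>card_conn_sets_contract\<close>). As \<open>n (n - 1) = (n - 1) (n - 2) + 2 (n - 1)\<close>,
  this is exactly what the induction needs.

  The contracted graph must again have no cut vertex. This holds as soon as removing both \<open>u\<close> and
  \<open>v\<close> leaves a connected graph, and an edge with this property exists by an extremal argument
  (lemma \<open>ex_nonseparating_edge\<close>).

  The counting takes place for vertex sets with a symmetric adjacency relation, where contraction
  is easy to express; connectedness is phrased as ``every nonempty proper part has an edge leaving
  it''. The last part of the theory translates from graphs to this setting.
\<close>

section \<open>Connected vertex sets of a symmetric relation\<close>

text \<open>
  Connectedness is expressed by cuts instead of paths, because a cut is easily transported along a
  contraction and an edge leaving a part is what all constructions below ask for.
\<close>

definition conn_on :: "('a \<Rightarrow> 'a \<Rightarrow> bool) \<Rightarrow> 'a set \<Rightarrow> bool" where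
  "conn_on E S \<longleftrightarrow> S \<noteq> {} \<and> (\<forall>A. A \<subset> S \<and> A \<noteq> {} \<longrightarrow> (\<exists>a\<in>A. \<exists>b\<in>S - A. E a b))"

definition conn_sets :: "('a \<Rightarrow> 'a \<Rightarrow> bool) \<Rightarrow> 'a set \<Rightarrow> 'a set set" where
  "conn_sets E V = {S. S \<subseteq> V \<and> conn_on E S}"

text \<open>
  A single vertex is not biconnected in this sense, because the empty set is not connected, but a
  single edge is. The latter is the base of the induction.
\<close>

definition biconn_on :: "('a \<Rightarrow> 'a \<Rightarrow> bool) \<Rightarrow> 'a set \<Rightarrow> bool" where
  "biconn_on E V \<longleftrightarrow> conn_on E V \<and> (\<forall>x\<in>V. conn_on E (V - {x}))"

lemma conn_onI:
  assumes "S \<noteq> {}" "\<And>A. \<lbrakk>A \<subset> S; A \<noteq> {}\<rbrakk> \<Longrightarrow> \<exists>a\<in>A. \<exists>b\<in>S - A. E a b"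
  shows "conn_on E S"
  using assms unfolding conn_on_def by blast

lemma conn_onE:
  assumes "conn_on E S" "A \<subset> S" "A \<noteq> {}"
  obtains a b where "a \<in> A" "b \<in> S - A" "E a b"
  using assms unfolding conn_on_def by blast

lemma conn_on_nonempty: "conn_on E S \<Longrightarrow> S \<noteq> {}"
  by (simp add: conn_on_def)

lemma conn_on_cong:
  assumes "\<And>x y. \<lbrakk>x \<in> S; y \<in> S\<rbrakk> \<Longrightarrow> E x y \<longleftrightarrow> F x y"
  shows "conn_on E S \<longleftrightarrow> conn_on F S"
proof -
  have "(\<exists>a\<in>A. \<exists>b\<in>S - A. E a b) \<longleftrightarrow> (\<exists>a\<in>A. \<exists>b\<in>S - A. F a b)" if "A \<subset> S" for A
    using that assms by (intro bex_cong) auto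
  then show ?thesis unfolding conn_on_def by simp
qed

lemma conn_on_singleton: "conn_on E {x}"
  by (auto simp: conn_on_def)

lemma conn_on_insert:
  assumes sym: "symp E" and S: "conn_on E S" and s: "s \<in> S" "E s b"
  shows "conn_on E (insert b S)"
proof (cases "b \<in> S")
  case True
  then show ?thesis using S by (simp add: insert_absorb)
next
  case bS: False
  show ?thesis
  proof (rule conn_onI)
    fix A assume A: "A \<subset> insert b S" "A \<noteq> {}"
    consider "A - {b} = {}" | "S \<subseteq> A" | "A - {b} \<noteq> {}" "\<not> S \<subseteq> A" by blast
    then show "\<exists>a\<in>A. \<exists>c\<in>insert b S - A. E a c"
    proof cases
      case 1
      then have "A = {b}" using A by auto
      then show ?thesis using A bS s sympD[OF sym s(2)] by auto
    next
      case 2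
      then have "b \<notin> A" using A by auto
      then show ?thesis using 2 s by blast
    next
      case 3
      have AS: "A \<inter> S \<subset> S" "A \<inter> S \<noteq> {}" using 3 A by auto
      obtain a c where "a \<in> A \<inter> S" "c \<in> S - A \<inter> S" "E a c" using conn_onE[OF S AS] .
      then show ?thesis by blast
    qed
  qed auto
qed

lemma finite_conn_sets: "finite V \<Longrightarrow> finite (conn_sets E V)"
  by (rule finite_subset[of _ "Pow V"]) (auto simp: conn_sets_def)

text \<open>
  A connected set through \<open>u\<close> that does not yet fill \<open>W\<close> has an edge leaving it inside \<open>W\<close>, and can
  absorb the other end of that edge. So connected sets through \<open>u\<close> of all sizes occur.
\<close>

lemma ex_conn_on_card:
  assumes sym: "symp E" and fin: "finite W" and W: "conn_on E W" and u: "u \<in> W"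
    and k: "1 \<le> k" "k \<le> card W"
  shows "\<exists>S\<subseteq>W. u \<in> S \<and> conn_on E S \<and> card S = k"
  using k
proof (induction k rule: dec_induct)
  case base
  show ?case using u conn_on_singleton by (intro exI[of _ "{u}"]) auto
next
  case (step k)
  then obtain S where S: "S \<subseteq> W" "u \<in> S" "conn_on E S" "card S = k" by auto
  then have SW: "S \<subset> W" using step by auto
  obtain a b where ab: "a \<in> S" "b \<in> W - S" "E a b"
    using conn_onE[OF W SW conn_on_nonempty[OF S(3)]] .
  have "conn_on E (insert b S)" using conn_on_insert[OF sym S(3) ab(1,3)] .
  moreover have "card (insert b S) = Suc k" using ab S finite_subset[OF S(1) fin] by simp
  ultimately show ?case using S ab by (intro exI[of _ "insert b S"]) auto
qed

lemma card_conn_sets_through: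
  assumes "symp E" "finite W" "conn_on E W" "u \<in> W"
  shows "card W \<le> card {S. S \<subseteq> W \<and> u \<in> S \<and> conn_on E S}" (is "_ \<le> card ?F")
proof -
  have "{1..card W} \<subseteq> card ` ?F"
  proof
    fix k assume "k \<in> {1..card W}"
    then show "k \<in> card ` ?F" using ex_conn_on_card[OF assms, of k] by (auto simp: image_iff)
  qed
  moreover have "finite ?F" using assms(2) by simp
  ultimately show ?thesis using surj_card_le by fastforce
qed

section \<open>Contracting an edge\<close>

text \<open>
  The vertex \<open>u\<close> takes over the neighbours of \<open>v\<close>; the relation is meant to be used on vertex sets
  without \<open>v\<close>. If \<open>uv\<close> is an edge, this creates a loop at \<open>u\<close>, which does not affect which sets are
  connected.
\<close>

definition contract :: "('a \<Rightarrow> 'a \<Rightarrow> bool) \<Rightarrow> 'a \<Rightarrow> 'a \<Rightarrow> 'a \<Rightarrow> 'a \<Rightarrow> bool" where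
  "contract E u v x y \<longleftrightarrow> E x y \<or> (x = u \<and> E v y) \<or> (y = u \<and> E x v)"

lemma symp_contract: "symp E \<Longrightarrow> symp (contract E u v)"
  by (auto simp: symp_def contract_def)

text \<open>
  A part \<open>A\<close> of the contracted set is pulled back to \<open>S\<close> by adding \<open>v\<close> if \<open>u\<close> is in \<open>A\<close>. An edge
  leaving the pulled-back part is then mapped to an edge leaving \<open>A\<close>.
\<close>

lemma conn_on_contract:
  assumes S: "conn_on E S" and u: "u \<in> S" "u \<noteq> v"
  shows "conn_on (contract E u v) (S - {v})"
proof (rule conn_onI)
  show "S - {v} \<noteq> {}" using u by auto
next
  fix A assume A: "A \<subset> S - {v}" "A \<noteq> {}"
  define B where "B = (if u \<in> A \<and> v \<in> S then insert v A else A)"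
  have B: "B \<subset> S" "B \<noteq> {}" using A u by (auto simp: B_def)
  obtain a b where ab: "a \<in> B" "b \<in> S - B" "E a b" using conn_onE[OF S B] .
  let ?r = "\<lambda>x. if x = v then u else x"
  have "?r a \<in> A" "?r b \<in> S - {v} - A" "contract E u v (?r a) (?r b)"
    using ab A u by (auto simp: B_def contract_def split: if_splits)
  then show "\<exists>a\<in>A. \<exists>b\<in>S - {v} - A. contract E u v a b" by blast
qed

lemma conn_on_contract_avoid:
  assumes "u \<notin> S"
  shows "conn_on (contract E u v) S \<longleftrightarrow> conn_on E S"
proof -
  show ?thesis by (rule conn_on_cong) (use assms in \<open>auto simp: contract_def\<close>)
qed

text \<open>
  A part of \<open>insert v S\<close> that separates \<open>u\<close> from \<open>v\<close> is left by the edge \<open>uv\<close> itself; any other part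
  comes from a part of \<open>S\<close>.
\<close>

lemma conn_on_uncontract:
  assumes sym: "symp E" and uv: "E u v" and S: "conn_on (contract E u v) S" and u: "u \<in> S" "v \<notin> S"
  shows "conn_on E (insert v S)"
proof (rule conn_onI)
  fix A assume A: "A \<subset> insert v S" "A \<noteq> {}"
  show "\<exists>a\<in>A. \<exists>b\<in>insert v S - A. E a b"
  proof (cases "u \<in> A \<longleftrightarrow> v \<in> A")
    case True
    then have AS: "A - {v} \<subset> S" "A - {v} \<noteq> {}" using A u by auto
    obtain a b where "a \<in> A - {v}" "b \<in> S - (A - {v})" "contract E u v a b"
      using conn_onE[OF S AS] .
    then show ?thesis using True u by (auto simp: contract_def)
  next
    case False
    then show ?thesis using uv sympD[OF sym uv] u by blast
  qed
qed auto

text \<open>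
  The three families counted here are disjoint: the lifted sets contain both or neither of \<open>u\<close> and
  \<open>v\<close>, the other two families consist of the sets that contain \<open>u\<close> but not \<open>v\<close>, and \<open>v\<close> but not
  \<open>u\<close>. Each of the latter has a member of every size from \<open>1\<close> to \<open>card V - 1\<close>.
\<close>

lemma card_conn_sets_contract:
  assumes sym: "symp E" and fin: "finite V" and V: "biconn_on E V"
    and uv: "u \<in> V" "v \<in> V" "u \<noteq> v" "E u v"
  shows "card (conn_sets (contract E u v) (V - {v})) + 2 * (card V - 1) \<le> card (conn_sets E V)"
proof -
  let ?C = "conn_sets (contract E u v) (V - {v})"
  define lift where "lift S = (if u \<in> S then insert v S else S)" for S
  define thru where "thru x y = {S. S \<subseteq> V - {y} \<and> x \<in> S \<and> conn_on E S}" for x y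
  have inj: "inj_on lift ?C"
  proof (rule inj_onI)
    fix S T assume "S \<in> ?C" "T \<in> ?C" "lift S = lift T"
    then have v: "v \<notin> S" "v \<notin> T" and eq: "lift S = lift T" by (auto simp: conn_sets_def)
    have "S = lift S - {v}" "T = lift T - {v}" using v by (auto simp: lift_def)
    with eq show "S = T" by simp
  qed
  have sub: "lift ` ?C \<subseteq> conn_sets E V"
    using uv conn_on_contract_avoid conn_on_uncontract[OF sym uv(4)]
    by (fastforce simp: lift_def conn_sets_def)
  have lo: "card V - 1 \<le> card (thru x y)" if "x \<in> V" "y \<in> V" "x \<noteq> y" for x y
    using card_conn_sets_through[OF sym, of "V - {y}" x] V fin that
    by (simp add: thru_def biconn_on_def)
  have fins: "finite (lift ` ?C)" "finite (thru u v)" "finite (thru v u)"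
    using fin by (auto simp: thru_def finite_conn_sets)
  have disj: "lift ` ?C \<inter> thru u v = {}" "(lift ` ?C \<union> thru u v) \<inter> thru v u = {}"
    by (auto simp: lift_def thru_def conn_sets_def split: if_splits)
  have "card ?C + 2 * (card V - 1) \<le> card (lift ` ?C) + card (thru u v) + card (thru v u)"
    using lo[of u v] lo[of v u] uv by (simp add: card_image[OF inj])
  also have "\<dots> = card (lift ` ?C \<union> thru u v \<union> thru v u)"
    using fins disj by (simp add: card_Un_disjoint)
  also have "\<dots> \<le> card (conn_sets E V)"
    using sub by (intro card_mono finite_conn_sets[OF fin]) (auto simp: thru_def conn_sets_def)
  finally show ?thesis .
qed

section \<open>A contractible edge\<close>

text \<open>
  Choose an edge \<open>uv\<close> and a connected set \<open>K\<close> avoiding \<open>u\<close> and \<open>v\<close> such that \<open>K\<close> is as large as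
  possible. Then no vertex outside \<open>K\<close> other than \<open>u\<close> and \<open>v\<close> is adjacent to \<open>K\<close>. Suppose that
  \<open>K\<close> misses a vertex besides these two. Since \<open>u\<close> is not a cut vertex, \<open>v\<close> has a neighbour \<open>w\<close>
  outside \<open>K\<close> and different from \<open>u\<close>; since \<open>v\<close> is not a cut vertex, \<open>u\<close> has a neighbour in \<open>K\<close>.
  So the edge \<open>vw\<close> and the connected set \<open>insert u K\<close> contradict the choice.
\<close>

lemma ex_nonseparating_edge:
  assumes sym: "symp E" and fin: "finite V" and V: "biconn_on E V" and n: "card V \<ge> 3"
  shows "\<exists>u\<in>V. \<exists>v\<in>V. u \<noteq> v \<and> E u v \<and> conn_on E (V - {u, v})"
proof -
  define P where "P = (\<lambda>(u, v, K). u \<in> V \<and> v \<in> V \<and> u \<noteq> v \<and> E u v \<and> K \<subseteq> V - {u, v} \<and> conn_on E K)"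
  have conn: "conn_on E V" and del: "\<And>x. x \<in> V \<Longrightarrow> conn_on E (V - {x})"
    using V by (auto simp: biconn_on_def)
  obtain x where x: "x \<in> V" using conn conn_on_nonempty by blast
  have "{x} \<noteq> V" using n by auto
  then have xV: "{x} \<subset> V" using x by blast
  obtain y where y: "y \<in> V - {x}" "E x y" using conn_onE[OF conn xV] by blast
  have "V - {x, y} \<noteq> {}"
  proof
    assume "V - {x, y} = {}"
    then have "card V \<le> card {x, y}" by (intro card_mono) auto
    then show False using n card_insert_le_m1[of 2 "{y}" x] by simp
  qed
  then obtain z where "z \<in> V - {x, y}" by blast
  then have "P (x, y, {z})" using x y by (auto simp: P_def conn_on_singleton)
  moreover have bound: "card (snd (snd t)) < Suc (card V)" if "P t" for t
  proof (cases t)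
    case (fields u v K)
    then show ?thesis using that by (auto simp: P_def less_Suc_eq_le intro!: card_mono fin)
  qed
  ultimately obtain t where t: "P t" "\<And>s. P s \<Longrightarrow> card (snd (snd s)) \<le> card (snd (snd t))"
    using ex_has_greatest_nat[of P _ "\<lambda>t. card (snd (snd t))"] by blast
  obtain u v K where tK: "t = (u, v, K)" by (cases t)
  have uv: "u \<in> V" "v \<in> V" "u \<noteq> v" "E u v" and K: "K \<subseteq> V - {u, v}" "conn_on E K"
    using t(1) by (auto simp: P_def tK)
  have finK: "finite K" using K fin finite_subset by blast
  have max: "card L \<le> card K" if "a \<in> V" "b \<in> V" "a \<noteq> b" "E a b" "L \<subseteq> V - {a, b}" "conn_on E L"
    for a b L
    using t(2)[of "(a, b, L)"] that by (simp add: P_def tK)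
  have closed: "\<not> E k w" if "k \<in> K" "w \<in> V - {u, v} - K" for k w
  proof
    assume "E k w"
    then have "conn_on E (insert w K)" using conn_on_insert[OF sym K(2)] that by blast
    then have "card (insert w K) \<le> card K" using uv K that by (intro max) auto
    then show False using that finK by simp
  qed
  have "K = V - {u, v}"
  proof (rule ccontr)
    assume ne: "K \<noteq> V - {u, v}"
    have K0: "K \<noteq> {}" using K conn_on_nonempty by blast
    have vK: "insert v K \<subset> V - {u}" using ne K uv by auto
    obtain a w where aw: "a \<in> insert v K" "w \<in> V - {u} - insert v K" "E a w"
      using conn_onE[OF del[OF uv(1)] vK insert_not_empty] .
    then have w: "w \<in> V - {u, v} - K" "E v w" using closed by auto
    have KV: "K \<subset> V - {v}" using K uv by auto
    obtain k c where "k \<in> K" "c \<in> V - {v} - K" "E k c"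
      using conn_onE[OF del[OF uv(2)] KV K0] .
    then have "k \<in> K" "E k u" using closed by auto
    then have "conn_on E (insert u K)" using conn_on_insert[OF sym K(2)] by blast
    then have "card (insert u K) \<le> card K" using uv K w by (intro max[of v w]) auto
    moreover have "u \<notin> K" using K by auto
    ultimately show False using finK by simp
  qed
  then show ?thesis using uv K by blast
qed

lemma biconn_on_contract:
  assumes V: "biconn_on E V" and uv: "u \<in> V" "v \<in> V" "u \<noteq> v" "conn_on E (V - {u, v})"
  shows "biconn_on (contract E u v) (V - {v})"
  unfolding biconn_on_def
proof (intro conjI ballI)
  show "conn_on (contract E u v) (V - {v})"
    using V uv by (intro conn_on_contract) (auto simp: biconn_on_def)
next
  fix x assume x: "x \<in> V - {v}"
  have eq: "V - {v} - {x} = V - {x} - {v}" by blast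
  show "conn_on (contract E u v) (V - {v} - {x})"
  proof (cases "x = u")
    case True
    have "V - {v} - {u} = V - {u, v}" by blast
    then show ?thesis using uv True by (simp add: conn_on_contract_avoid)
  next
    case False
    then show ?thesis unfolding eq
      using V uv x by (intro conn_on_contract) (auto simp: biconn_on_def)
  qed
qed

lemma card_conn_sets_biconn:
  assumes "symp E" "finite V" "biconn_on E V" "card V \<ge> 2"
  shows "card V * (card V - 1) + 1 \<le> card (conn_sets E V)"
  using assms
proof (induction "card V" arbitrary: E V rule: less_induct)
  case less
  show ?case
  proof (cases "card V = 2")
    case True
    then obtain a b where ab: "V = {a, b}" "a \<noteq> b" by (metis card_2_iff)
    have "{{a}, {b}, {a, b}} \<subseteq> conn_sets E V"
      using less.prems ab by (auto simp: conn_sets_def conn_on_singleton biconn_on_def)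
    from card_mono[OF finite_conn_sets[OF less.prems(2)] this] show ?thesis
      using ab by (simp add: doubleton_eq_iff)
  next
    case False
    then obtain u v where uv: "u \<in> V" "v \<in> V" "u \<noteq> v" "E u v" "conn_on E (V - {u, v})"
      using ex_nonseparating_edge[of E V] less.prems by auto
    define m where "m = card V - 1"
    have m: "card (V - {v}) = m" "card V = Suc m" "m \<ge> 2"
      using uv less.prems False by (auto simp: m_def)
    then have "m * (m - 1) + 1 \<le> card (conn_sets (contract E u v) (V - {v}))"
      using less.hyps[of "V - {v}" "contract E u v"] less.prems uv
        symp_contract[of E u v] biconn_on_contract[of E V u v] by simp
    moreover have "card (conn_sets (contract E u v) (V - {v})) + 2 * m \<le> card (conn_sets E V)"
      using card_conn_sets_contract[of E V u v] less.prems uv m by simp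
    moreover have "Suc m * m = m * (m - 1) + 2 * m" by (cases m) auto
    ultimately show ?thesis using m by simp
  qed
qed

section \<open>Connected sets of the cycle\<close>

text \<open>
  A connected proper subset \<open>S\<close> of the cycle is an arc: pick \<open>s\<close> in \<open>S\<close> whose predecessor \<open>p\<close> is not
  in \<open>S\<close>, and follow the cycle from \<open>s\<close> until it first leaves \<open>S\<close>, after \<open>k\<close> steps. The arc passed
  on the way is adjacent only to two vertices outside \<open>S\<close>, so it is all of \<open>S\<close>. The relation
  may be any subrelation of adjacency in the cycle: with fewer edges, fewer sets are connected.
\<close>

lemma card_conn_sets_cycle_le:
  fixes E :: "nat \<Rightarrow> nat \<Rightarrow> bool"
  assumes n: "n \<ge> 2"
    and E: "\<And>i j. E i j \<Longrightarrow> j = Suc i mod n \<or> i = Suc j mod n"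
  shows "card (conn_sets E {..<n}) \<le> n * (n - 1) + 1"
proof -
  define arc where "arc = (\<lambda>(s, k). (\<lambda>i. (s + i) mod n) ` {..<k})"
  have "conn_sets E {..<n} \<subseteq> insert {..<n} (arc ` ({..<n} \<times> {1..n - 1}))"
  proof (rule subsetI, rule insertCI)
    fix S assume "S \<in> conn_sets E {..<n}" and full: "S \<notin> arc ` ({..<n} \<times> {1..n - 1})"
    then have S: "S \<subseteq> {..<n}" "conn_on E S" by (auto simp: conn_sets_def)
    show "S = {..<n}"
    proof (rule ccontr)
      assume ne: "S \<noteq> {..<n}"
      then obtain x where x: "x < n" "x \<notin> S" using S by auto
      obtain y where y: "y \<in> S" using S conn_on_nonempty by blast
      then have yn: "y < n" using S by auto
      have reach: "(x + (n + y - x)) mod n \<in> S" using x y yn by simp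
      \<comment> \<open>Start outside \<open>S\<close> and walk until \<open>S\<close> is entered; this happens at \<open>s\<close>, coming from \<open>p\<close>.\<close>
      define j where "j = (LEAST j. (x + j) mod n \<in> S)"
      have j: "(x + j) mod n \<in> S" unfolding j_def by (rule LeastI, rule reach)
      have "j \<noteq> 0" using j x by (intro notI) simp
      then have "(x + (j - 1)) mod n \<notin> S"
        using not_less_Least[of "j - 1" "\<lambda>j. (x + j) mod n \<in> S", folded j_def] by simp
      define s where "s = (x + j) mod n"
      define p where "p = (x + (j - 1)) mod n"
      have s: "s \<in> S" "s < n" and p: "p \<notin> S" "p < n" "Suc p mod n = s"
        using j \<open>j \<noteq> 0\<close> \<open>(x + (j - 1)) mod n \<notin> S\<close> n by (auto simp: s_def p_def mod_Suc_eq)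
      have pred: "(s + (n - 1)) mod n = p"
      proof -
        have "(s + (n - 1)) mod n = (Suc p + (n - 1)) mod n"
          unfolding p(3)[symmetric] by (rule mod_add_left_eq)
        also have "Suc p + (n - 1) = p + n" using n by simp
        finally show ?thesis using p by simp
      qed
      define k where "k = (LEAST k. (s + k) mod n \<notin> S)"
      have exit: "(s + (n - 1)) mod n \<notin> S" using p pred by simp
      have k: "(s + k) mod n \<notin> S"
        unfolding k_def by (rule LeastI[of "\<lambda>k. (s + k) mod n \<notin> S", OF exit])
      have kle: "k \<le> n - 1" unfolding k_def by (rule Least_le, rule exit)
      have k0: "k \<noteq> 0" using k s by (intro notI) simp
      have in_arc: "(s + i) mod n \<in> arc (s, k)" if "i < k" for i
        using that by (simp add: arc_def)
      have below: "(s + i) mod n \<in> S" if "i < k" for i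
        using not_less_Least[of i] that unfolding k_def by blast
      have "arc (s, k) \<subseteq> S" using below by (auto simp: arc_def)
      moreover have "(s, k) \<in> {..<n} \<times> {1..n - 1}" using s kle k0 by simp
      then have "arc (s, k) \<noteq> S" using full by blast
      moreover have "arc (s, k) \<noteq> {}" using k0 by (simp add: arc_def lessThan_empty_iff)
      ultimately have arc: "arc (s, k) \<subset> S" "arc (s, k) \<noteq> {}" by auto
      obtain a b where ab: "a \<in> arc (s, k)" "b \<in> S - arc (s, k)" "E a b"
        using conn_onE[OF S(2) arc] .
      from ab(1) obtain i where i: "i < k" "a = (s + i) mod n" by (auto simp: arc_def)
      have bn: "b < n" using ab S by auto
      \<comment> \<open>The edge from \<open>a\<close> to \<open>b\<close> leaves the arc forwards or backwards.
          It would have to end in \<open>s + k\<close> or in \<open>p\<close>, neither of which is in \<open>S\<close>.\<close>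
      from E[OF ab(3)] show False
      proof
        assume "b = Suc a mod n"
        then have b: "b = (s + Suc i) mod n" using i by (simp add: mod_Suc_eq)
        show False
        proof (cases "Suc i < k")
          case True
          then show False using ab in_arc[of "Suc i"] unfolding b by blast
        next
          case False
          then have "Suc i = k" using i by simp
          then show False using ab b k by simp
        qed
      next
        assume a: "a = Suc b mod n"
        have b: "b = (a + (n - 1)) mod n"
        proof -
          have "(a + (n - 1)) mod n = (Suc b + (n - 1)) mod n"
            unfolding a by (rule mod_add_left_eq)
          also have "Suc b + (n - 1) = b + n" using n by simp
          finally show ?thesis using bn by simp
        qed
        show False
        proof (cases i)
          case 0
          then have "b = p" using b i s pred by simp
          then show False using ab p by simp
        next
          case (Suc i')
          have "b = (s + i + (n - 1)) mod n" unfolding b i by (rule mod_add_left_eq)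
          also have "s + i + (n - 1) = s + i' + n" using Suc n by simp
          finally have "b = (s + i') mod n" by simp
          then show False using ab i Suc in_arc[of i'] by simp
        qed
      qed
    qed
  qed
  then have "card (conn_sets E {..<n}) \<le> card (insert {..<n} (arc ` ({..<n} \<times> {1..n - 1})))"
    by (intro card_mono) auto
  also have "\<dots> \<le> Suc (card (arc ` ({..<n} \<times> {1..n - 1})))" by (simp add: card_insert_if)
  also have "card (arc ` ({..<n} \<times> {1..n - 1})) \<le> card ({..<n} \<times> {1..n - 1})"
    by (rule card_image_le) simp
  finally show ?thesis by simp
qed

section \<open>Connectedness of graphs in terms of adjacency\<close>

text \<open>
  A directed path from inside \<open>A\<close> to outside \<open>A\<close> uses an arc leaving \<open>A\<close>. Conversely, no arc leaves
  the set of vertices reachable from a given one, so that this set contains every vertex.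
\<close>

lemma (in sym_digraph) connected_iff_conn_on: "connected G \<longleftrightarrow> conn_on (dominates G) (verts G)"
proof
  assume "connected G"
  then have sc: "strongly_connected G" by (rule symmetric_connected_imp_strongly_connected[OF sym_arcs])
  show "conn_on (dominates G) (verts G)"
  proof (rule conn_onI)
    show "verts G \<noteq> {}" using sc by (auto simp: strongly_connected_def)
  next
    fix A assume A: "A \<subset> verts G" "A \<noteq> {}"
    then obtain a b where ab: "a \<in> A" "b \<in> verts G - A" by blast
    then have "a \<rightarrow>\<^sup>* b" using sc A by (auto simp: strongly_connected_def)
    then have "b \<in> A \<or> (\<exists>x\<in>A. \<exists>y\<in>verts G - A. x \<rightarrow>\<^bsub>G\<^esub> y)"
      by (induction rule: reachable_induct) (use ab in \<open>auto dest: adj_in_verts\<close>)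
    then show "\<exists>x\<in>A. \<exists>y\<in>verts G - A. x \<rightarrow>\<^bsub>G\<^esub> y" using ab by blast
  qed
next
  assume c: "conn_on (dominates G) (verts G)"
  have "a \<rightarrow>\<^sup>* b" if ab: "a \<in> verts G" "b \<in> verts G" for a b
  proof -
    have "{x. a \<rightarrow>\<^sup>* x} = verts G"
    proof (rule ccontr)
      assume "{x. a \<rightarrow>\<^sup>* x} \<noteq> verts G"
      then have "{x. a \<rightarrow>\<^sup>* x} \<subset> verts G" by (auto dest: reachable_in_verts)
      moreover have "{x. a \<rightarrow>\<^sup>* x} \<noteq> {}" using ab by auto
      ultimately obtain x y where "a \<rightarrow>\<^sup>* x" "\<not> a \<rightarrow>\<^sup>* y" "x \<rightarrow>\<^bsub>G\<^esub> y"
        by (rule conn_onE[OF c]) auto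
      then show False using reachable_adj_trans by blast
    qed
    then show ?thesis using ab by blast
  qed
  then have "strongly_connected G"
    using conn_on_nonempty[OF c] by (auto simp: strongly_connected_def)
  then show "connected G" using strongly_connected_imp_connected wf_digraph_axioms by blast
qed

lemma (in sym_digraph) symp_dominates: "symp (dominates G)"
  using sym_arcs by (auto simp: symp_def symmetric_def elim: symE)

lemma (in sym_digraph) connected_induce_iff_conn_on:
  assumes "S \<subseteq> verts G"
  shows "connected (G \<restriction> S) \<longleftrightarrow> conn_on (dominates G) S"
proof -
  interpret I: wf_digraph "G \<restriction> S" by (rule wellformed_induce_subgraph)
  have "symmetric (G \<restriction> S)"
    using sym_arcs induced_induce[OF assms] by (rule induced_graph_imp_symmetric)
  then interpret I: sym_digraph "G \<restriction> S" by (rule I.sym_digraphI)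
  have "connected (G \<restriction> S) \<longleftrightarrow> conn_on (dominates (G \<restriction> S)) S"
    using I.connected_iff_conn_on by simp
  also have "\<dots> \<longleftrightarrow> conn_on (dominates G) S"
    by (rule conn_on_cong) (auto simp: arcs_ends_def arc_to_ends_def image_iff)
  finally show ?thesis .
qed

lemma (in sym_digraph) num_connected_induced_eq:
  "num_connected_induced G = card (conn_sets (dominates G) (verts G))"
  unfolding num_connected_induced_def conn_sets_def
  by (rule arg_cong[of _ _ card])
    (use connected_induce_iff_conn_on conn_on_nonempty in blast)

text \<open>
  A connected graph has one component, so after removing a vertex that is not a cut vertex there is
  at most one. All remaining vertices therefore lie in the same strongly connected component.
\<close>

lemma (in pseudo_graph) biconn_on_if_no_cut_vertex:
  assumes "connected G" "\<not> (\<exists>u. cut_vertex G u)" "card (verts G) \<ge> 2"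
  shows "biconn_on (dominates G) (verts G)"
  unfolding biconn_on_def
proof (intro conjI ballI)
  show "conn_on (dominates G) (verts G)" using assms(1) connected_iff_conn_on by simp
next
  fix u assume u: "u \<in> verts G"
  have sc: "strongly_connected G"
    using assms(1) by (rule symmetric_connected_imp_strongly_connected[OF sym_arcs])
  have "components G = {G}"
    using sc sym_digraph_axioms by (simp add: components_eq_sccs strongly_connected_eq_iff)
  then have le: "card (components (del_vert u)) \<le> 1"
    using assms(2) u by (auto simp: cut_vertex_def not_less)
  interpret D: fin_digraph "del_vert u" by (rule fin_digraph_del_vert)
  have dom: "x \<rightarrow>\<^bsub>del_vert u\<^esub> y \<longleftrightarrow> x \<rightarrow>\<^bsub>G\<^esub> y \<and> x \<noteq> u \<and> y \<noteq> u" for x y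
    by (auto simp: arcs_ends_def arc_to_ends_def del_vert_simps image_iff)
  have "symmetric (del_vert u)"
    using symp_dominates by (auto simp: symmetric_def sym_def dom symp_def)
  then interpret D: sym_digraph "del_vert u" by (rule D.sym_digraphI)
  have "card D.sccs_verts \<le> 1"
    using le by (simp add: D.card_sccs_verts components_eq_sccs[OF D.sym_digraph_axioms])
  then have one: "A = B" if "A \<in> D.sccs_verts" "B \<in> D.sccs_verts" for A B
    using that D.finite_sccs_verts by (metis card_le_Suc0_iff_eq One_nat_def)
  have "a \<rightarrow>\<^sup>*\<^bsub>del_vert u\<^esub> b" if "a \<in> verts (del_vert u)" "b \<in> verts (del_vert u)" for a b
  proof -
    have "D.scc_of a = D.scc_of b"
      using one that D.scc_of_in_sccs_verts by blast
    then show ?thesis using D.in_scc_of_self[OF that(2)] unfolding D.scc_of_def by blast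
  qed
  moreover have "verts (del_vert u) \<noteq> {}"
    using assms(3) u card_mono[of "{u}" "verts G"] by (auto simp: del_vert_simps)
  ultimately have "strongly_connected (del_vert u)" by (auto simp: strongly_connected_def)
  then have "connected (del_vert u)"
    using strongly_connected_imp_connected D.wf_digraph_axioms by blast
  then have "conn_on (dominates (del_vert u)) (verts G - {u})"
    using D.connected_iff_conn_on by (simp add: del_vert_simps)
  then show "conn_on (dominates G) (verts G - {u})"
    using conn_on_cong[of "verts G - {u}" "dominates (del_vert u)" "dominates G"] dom by blast
qed

section \<open>The cycle minimises the number of connected sets\<close>

theorem theorem13:
  fixes n :: nat and G :: "('a, 'b) pre_digraph"
  assumes "n \<ge> 3"
    and "graph G"
    and "card (verts G) = n"
    and "connected G"
    and "\<not> (\<exists>u. cut_vertex G u)"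
  shows "num_connected_induced G \<ge> num_connected_induced (cycle_graph n)"
proof -
  interpret G: graph G by fact
  interpret C: graph "cycle_graph n" using assms(1) by (rule graph_cycle_graph)
  have dom: "j = Suc i mod n \<or> i = Suc j mod n" if "i \<rightarrow>\<^bsub>cycle_graph n\<^esub> j" for i j
    using that by (auto simp: arcs_ends_def arc_to_ends_def cycle_graph_def)
  have "num_connected_induced (cycle_graph n)
      = card (conn_sets (dominates (cycle_graph n)) {..<n})"
    unfolding C.num_connected_induced_eq by (simp add: cycle_graph_def)
  also have "\<dots> \<le> n * (n - 1) + 1"
    using assms(1) dom by (intro card_conn_sets_cycle_le) auto
  also have "\<dots> \<le> card (conn_sets (dominates G) (verts G))"
    using card_conn_sets_biconn[OF G.symp_dominates, of "verts G"]
      G.biconn_on_if_no_cut_vertex assms by simp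
  also have "\<dots> = num_connected_induced G" by (simp add: G.num_connected_induced_eq)
  finally show ?thesis .
qed

end
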